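(* Let $\Omega\subseteq\mathbb{R}^n$ be open and let $\widetilde R=[R]\in\mathcal{G}^e(\Omega)$. Then $\widetilde R=0$ in $\mathcal{G}^e(\Omega)$ if and only if $\widetilde R(\widetilde X)=0$ in $\widetilde{\mathbb{C}}(n)$ for all $\widetilde X\in\widetilde\Omega_c(n)$.
   Context: Notation. $n\in\mathbb{N}=\{1,2,\dots\}$, $\mathbb{N}_0=\mathbb{N}\cup\{0\}$, $\Omega\subseteq\mathbb{R}^n$ open. $K\subset\subset\Omega$ means $K$ is a compact subset of $\Omega$. For expressions defined for small $\varepsilon>0$, $f(\varepsilon)=O(g(\varepsilon))$ means $\exists C>0\ \exists\varepsilon_0>0\ \forall\varepsilon<\varepsilon_0$: $|f(\varepsilon)|<C|g(\varepsilon)|$. $\mathcal{D}(\mathbb{R}^n)$ is the space of smooth compactly supported (complex-valued) functions. For $q\in\mathbb{N}_0$, $\mathcal{A}_q(\mathbb{R}^n)$ is the set of $\varphi\in\mathcal{D}(\mathbb{R}^n)$ with $\int\varphi=1$ and $\int x^\alpha\varphi(x)\,dx=0$ for all multi-indices $\alpha$ with $1\le|\alpha|\le q$. For $\varepsilon>0$, $(S_\varepsilon\varphi)(y):=\varepsilon^{-n}\varphi(y/\varepsilon)$. $U(\Omega):=\{(\varphi,x)\in\mathcal{A}_0(\mathbb{R}^n)\times\Omega: \operatorname{supp}\varphi+x\subseteq\Omega\}$. The algebra $\mathcal{G}^e(\Omega)$. $\mathcal{E}^e(\Omega)$ is the set of functions $R:U(\Omega)\to\mathbb{C}$ that are smooth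 in the second variable $x$; $\partial^\alpha$ denotes derivatives with respect to $x$. $R$ is moderate ($R\in\mathcal{E}^e_M(\Omega)$) if $\forall K\subset\subset\Omega\ \forall\alpha\in\mathbb{N}_0^n\ \exists N\in\mathbb{N}\ \forall\varphi\in\mathcal{A}_N(\mathbb{R}^n)$: $\sup_{x\in K}|\partial^\alpha R(S_\varepsilon\varphi,x)|=O(\varepsilon^{-N})$. $R$ is negligible ($R\in\mathcal{N}^e(\Omega)$) if $\forall K\subset\subset\Omega\ \forall\alpha\in\mathbb{N}_0^n\ \forall m\in\mathbb{N}\ \exists q\in\mathbb{N}\ \forall\varphi\in\mathcal{A}_q(\mathbb{R}^n)$: $\sup_{x\in K}|\partial^\alpha R(S_\varepsilon\varphi,x)|=O(\varepsilon^{m})$. $\mathcal{G}^e(\Omega):=\mathcal{E}^e_M(\Omega)/\mathcal{N}^e(\Omega)$ with pointwise operations. Generalized numbers. $\mathbb{C}_M(n)$ is the set of $r:\mathcal{A}_0(\mathbb{R}^n)\to\mathbb{C}$ such that $\exists N\in\mathbb{N}\ \forall\varphi\in\mathcal{A}_N(\mathbb{R}^n)$: $|r(S_\varepsilon\varphi)|=O(\varepsilon^{-N})$; $\mathbb{C}_N(n)$ is the set of $r:\mathcal{A}_0(\mathbb{R}^n)\to\mathbb{C}$ such that $\forall m\in\mathbb{N}\ \exists q\in\mathbb{N}\ \forall\varphi\in\mathcal{A}_q(\mathbb{R}^n)$: $|r(S_\varepsilon\varphi)|=O(\varepsilon^m)$; $\widetilde{\mathbb{C}}(n):=\mathbb{C}_M(n)/\mathbb{C}_N(n)$.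 Generalized points. $\Omega_M(n)$ is the set of maps $X:\mathcal{A}_0(\mathbb{R}^n)\to\Omega$ such that (a) $\forall\varphi\in\mathcal{A}_0(\mathbb{R}^n)\ \exists\varepsilon_0>0\ \forall\varepsilon<\varepsilon_0$: $(S_\varepsilon\varphi,X(S_\varepsilon\varphi))\in U(\Omega)$, and (b) $\exists N\in\mathbb{N}\ \forall\varphi\in\mathcal{A}_N(\mathbb{R}^n)$: $|X(S_\varepsilon\varphi)|=O(\varepsilon^{-N})$. For $X,Y\in\Omega_M(n)$, $X\sim Y$ means $\forall m\in\mathbb{N}\ \exists q\in\mathbb{N}\ \forall\varphi\in\mathcal{A}_q(\mathbb{R}^n)$: $|X(S_\varepsilon\varphi)-Y(S_\varepsilon\varphi)|=O(\varepsilon^m)$. $\widetilde\Omega(n):=\Omega_M(n)/\sim$. $X\in\Omega_M(n)$ is compactly supported if $\exists K\subset\subset\Omega\ \exists N\in\mathbb{N}\ \forall\varphi\in\mathcal{A}_N(\mathbb{R}^n)\ \exists\eta>0\ \forall\varepsilon<\eta$: $X(S_\varepsilon\varphi)\in K$. $\widetilde\Omega_c(n)$ is the set of classes in $\widetilde\Omega(n)$ having one (equivalently, only) compactly supported representative(s). Point values. For $R\in\mathcal{E}^e_M(\Omega)$ and compactly supported $X\in\Omega_M(n)$, $R(X):\mathcal{A}_0(\mathbb{R}^n)\to\mathbb{C}$ is given by $R(X)(\varphi):=R(\varphi,X(\varphi))$ if $(\varphi,X(\varphi))\in U(\Omega)$ and $R(X)(\varphi):=0$ otherwise. For $\widetilde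 R=[R]\in\mathcal{G}^e(\Omega)$ and $\widetilde X=[X]\in\widetilde\Omega_c(n)$, the point value $\widetilde R(\widetilde X)\in\widetilde{\mathbb{C}}(n)$ is the class of $R(X)$ (this is well defined). *)

theory Defs
  imports "HOL-Analysis.Analysis" "HOL-Algebra.QuotRing"
begin

section \<open>Smooth functions and multi-index derivatives\<close>

definition partial_deriv :: "'n::finite \<Rightarrow> (real^'n \<Rightarrow> complex) \<Rightarrow> real^'n \<Rightarrow> complex" where
  "partial_deriv i f x = vector_derivative (\<lambda>t. f (x + t *\<^sub>R axis i 1)) (at 0)"

text \<open>All iterated partial derivatives, in any order of the directions, exist and are
  continuous. This is meant for open \<open>S\<close>.\<close>
definition smooth_on :: "(real^'n::finite) set \<Rightarrow> (real^'n \<Rightarrow> complex) \<Rightarrow> bool" where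
  "smooth_on S f \<longleftrightarrow>
     (\<forall>is. continuous_on S (foldr partial_deriv is f) \<and>
       (\<forall>i. \<forall>x\<in>S. (\<lambda>t::real. foldr partial_deriv is f (x + t *\<^sub>R axis i 1)) differentiable (at 0)))"

text \<open>The index type \<open>'n\<close> carries no order, so the coordinates are enumerated by an
  arbitrary fixed list; for smooth functions the choice is immaterial.\<close>
definition index_list :: "'n::finite list" where
  "index_list = (SOME is. distinct is \<and> set is = UNIV)"

definition multi_deriv :: "('n::finite \<Rightarrow> nat) \<Rightarrow> (real^'n \<Rightarrow> complex) \<Rightarrow> real^'n \<Rightarrow> complex" where
  "multi_deriv \<alpha> f = foldr (\<lambda>i. partial_deriv i ^^ \<alpha> i) index_list f"

section \<open>Test functions\<close>

type_synonym 'n test_fun = "real^'n \<Rightarrow> complex"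

definition fun_supp :: "'n::finite test_fun \<Rightarrow> (real^'n) set" where
  "fun_supp \<phi> = closure {x. \<phi> x \<noteq> 0}"

definition test_functions :: "'n::finite test_fun set" where
  "test_functions = {\<phi>. smooth_on UNIV \<phi> \<and> compact (fun_supp \<phi>)}"

definition mollifiers :: "nat \<Rightarrow> 'n::finite test_fun set" where
  "mollifiers q = {\<phi> \<in> test_functions. (LINT x|lborel. \<phi> x) = 1 \<and>
     (\<forall>\<alpha>::'n \<Rightarrow> nat. 1 \<le> (\<Sum>i\<in>UNIV. \<alpha> i) \<and> (\<Sum>i\<in>UNIV. \<alpha> i) \<le> q \<longrightarrow>
        (LINT x|lborel. complex_of_real (\<Prod>i\<in>UNIV. (x $ i) ^ \<alpha> i) * \<phi> x) = 0)}"

definition scale_fun :: "real \<Rightarrow> 'n::finite test_fun \<Rightarrow> 'n test_fun" where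
  "scale_fun \<epsilon> \<phi> = (\<lambda>y. complex_of_real (inverse (\<epsilon> ^ CARD('n))) * \<phi> (inverse \<epsilon> *\<^sub>R y))"

definition U_set :: "(real^'n::finite) set \<Rightarrow> ('n test_fun \<times> (real^'n)) set" where
  "U_set \<Omega> = {(\<phi>, x). \<phi> \<in> mollifiers 0 \<and> x \<in> \<Omega> \<and> (\<lambda>y. y + x) ` fun_supp \<phi> \<subseteq> \<Omega>}"

text \<open>\<open>O\<close>-estimates for \<open>\<epsilon> \<rightarrow> 0+\<close>. The left-hand side takes values in \<^typ>\<open>ennreal\<close>
  so that suprema over arbitrary sets are meaningful: an unbounded family has supremum
  \<open>\<infinity>\<close> and the empty family has supremum \<open>0\<close>.\<close>
definition eps_bigo :: "(real \<Rightarrow> ennreal) \<Rightarrow> (real \<Rightarrow> real) \<Rightarrow> bool" where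
  "eps_bigo f g \<longleftrightarrow>
     (\<exists>C>0. \<exists>\<epsilon>\<^sub>0>0. \<forall>\<epsilon>. 0 < \<epsilon> \<and> \<epsilon> < \<epsilon>\<^sub>0 \<longrightarrow> f \<epsilon> < ennreal (C * \<bar>g \<epsilon>\<bar>))"

section \<open>The algebra of generalized functions\<close>

text \<open>Functions on \<^term>\<open>U_set \<Omega>\<close> are represented by total curried functions; values
  outside \<^term>\<open>U_set \<Omega>\<close> are arbitrary, and functions agreeing on \<^term>\<open>U_set \<Omega>\<close> differ by
  a negligible one. No estimate below depends on the values outside \<^term>\<open>U_set \<Omega>\<close>:
  for \<open>\<phi> \<in> mollifiers 0\<close>, compact \<open>K \<subseteq> \<Omega>\<close> and small \<open>\<epsilon>\<close> all pairs
  \<open>(scale_fun \<epsilon> \<phi>, x)\<close> with \<open>x \<in> K\<close> lie in \<^term>\<open>U_set \<Omega>\<close>, whose sections are open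
  for open \<open>\<Omega>\<close>.\<close>
definition basic_space :: "(real^'n::finite) set \<Rightarrow> ('n test_fun \<Rightarrow> real^'n \<Rightarrow> complex) set" where
  "basic_space \<Omega> = {R. \<forall>\<phi>\<in>mollifiers 0. smooth_on {x. (\<phi>, x) \<in> U_set \<Omega>} (R \<phi>)}"

definition moderate :: "(real^'n::finite) set \<Rightarrow> ('n test_fun \<Rightarrow> real^'n \<Rightarrow> complex) set" where
  "moderate \<Omega> = {R \<in> basic_space \<Omega>.
     \<forall>K. compact K \<and> K \<subseteq> \<Omega> \<longrightarrow> (\<forall>\<alpha>. \<exists>N\<ge>1. \<forall>\<phi>\<in>mollifiers N.
       eps_bigo (\<lambda>\<epsilon>. SUP x\<in>K. ennreal (cmod (multi_deriv \<alpha> (R (scale_fun \<epsilon> \<phi>)) x)))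
         (\<lambda>\<epsilon>. inverse (\<epsilon> ^ N)))}"

definition negligible_funs :: "(real^'n::finite) set \<Rightarrow> ('n test_fun \<Rightarrow> real^'n \<Rightarrow> complex) set" where
  "negligible_funs \<Omega> = {R \<in> basic_space \<Omega>.
     \<forall>K. compact K \<and> K \<subseteq> \<Omega> \<longrightarrow> (\<forall>\<alpha>. \<forall>m\<ge>1. \<exists>q\<ge>1. \<forall>\<phi>\<in>mollifiers q.
       eps_bigo (\<lambda>\<epsilon>. SUP x\<in>K. ennreal (cmod (multi_deriv \<alpha> (R (scale_fun \<epsilon> \<phi>)) x)))
         (\<lambda>\<epsilon>. \<epsilon> ^ m))}"

definition moderate_ring ::
    "(real^'n::finite) set \<Rightarrow> ('n test_fun \<Rightarrow> real^'n \<Rightarrow> complex) ring" where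
  "moderate_ring \<Omega> =
     \<lparr>carrier = moderate \<Omega>,
      mult = (\<lambda>R S \<phi> x. R \<phi> x * S \<phi> x),
      one = (\<lambda>\<phi> x. 1),
      zero = (\<lambda>\<phi> x. 0),
      add = (\<lambda>R S \<phi> x. R \<phi> x + S \<phi> x)\<rparr>"

definition gen_functions ::
    "(real^'n::finite) set \<Rightarrow> ('n test_fun \<Rightarrow> real^'n \<Rightarrow> complex) set ring" where
  "gen_functions \<Omega> = moderate_ring \<Omega> Quot negligible_funs \<Omega>"

section \<open>Generalized numbers\<close>

definition moderate_numbers :: "('n::finite test_fun \<Rightarrow> complex) set" where
  "moderate_numbers = {r. \<exists>N\<ge>1. \<forall>\<phi>\<in>mollifiers N.
     eps_bigo (\<lambda>\<epsilon>. ennreal (cmod (r (scale_fun \<epsilon> \<phi>)))) (\<lambda>\<epsilon>. inverse (\<epsilon> ^ N))}"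

definition negligible_numbers :: "('n::finite test_fun \<Rightarrow> complex) set" where
  "negligible_numbers = {r. \<forall>m\<ge>1. \<exists>q\<ge>1. \<forall>\<phi>\<in>mollifiers q.
     eps_bigo (\<lambda>\<epsilon>. ennreal (cmod (r (scale_fun \<epsilon> \<phi>)))) (\<lambda>\<epsilon>. \<epsilon> ^ m)}"

definition moderate_numbers_ring :: "('n::finite test_fun \<Rightarrow> complex) ring" where
  "moderate_numbers_ring =
     \<lparr>carrier = moderate_numbers,
      mult = (\<lambda>r s \<phi>. r \<phi> * s \<phi>),
      one = (\<lambda>\<phi>. 1),
      zero = (\<lambda>\<phi>. 0),
      add = (\<lambda>r s \<phi>. r \<phi> + s \<phi>)\<rparr>"

definition gen_numbers :: "('n::finite test_fun \<Rightarrow> complex) set ring" where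
  "gen_numbers = moderate_numbers_ring Quot negligible_numbers"

section \<open>Generalized points\<close>

definition point_reps :: "(real^'n::finite) set \<Rightarrow> ('n test_fun \<Rightarrow> real^'n) set" where
  "point_reps \<Omega> = {X. (\<forall>\<phi>\<in>mollifiers 0. X \<phi> \<in> \<Omega>) \<and>
     (\<forall>\<phi>\<in>mollifiers 0. \<exists>\<epsilon>\<^sub>0>0. \<forall>\<epsilon>. 0 < \<epsilon> \<and> \<epsilon> < \<epsilon>\<^sub>0 \<longrightarrow>
        (scale_fun \<epsilon> \<phi>, X (scale_fun \<epsilon> \<phi>)) \<in> U_set \<Omega>) \<and>
     (\<exists>N\<ge>1. \<forall>\<phi>\<in>mollifiers N.
        eps_bigo (\<lambda>\<epsilon>. ennreal (norm (X (scale_fun \<epsilon> \<phi>)))) (\<lambda>\<epsilon>. inverse (\<epsilon> ^ N)))}"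

definition point_rel ::
    "(real^'n::finite) set \<Rightarrow> (('n test_fun \<Rightarrow> real^'n) \<times> ('n test_fun \<Rightarrow> real^'n)) set" where
  "point_rel \<Omega> = {(X, Y). X \<in> point_reps \<Omega> \<and> Y \<in> point_reps \<Omega> \<and>
     (\<forall>m\<ge>1. \<exists>q\<ge>1. \<forall>\<phi>\<in>mollifiers q.
        eps_bigo (\<lambda>\<epsilon>. ennreal (norm (X (scale_fun \<epsilon> \<phi>) - Y (scale_fun \<epsilon> \<phi>)))) (\<lambda>\<epsilon>. \<epsilon> ^ m))}"

definition gen_points :: "(real^'n::finite) set \<Rightarrow> ('n test_fun \<Rightarrow> real^'n) set set" where
  "gen_points \<Omega> = point_reps \<Omega> // point_rel \<Omega>"

definition compactly_supported_rep ::
    "(real^'n::finite) set \<Rightarrow> ('n test_fun \<Rightarrow> real^'n) \<Rightarrow> bool" where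
  "compactly_supported_rep \<Omega> X \<longleftrightarrow>
     (\<exists>K. compact K \<and> K \<subseteq> \<Omega> \<and> (\<exists>N\<ge>1. \<forall>\<phi>\<in>mollifiers N.
        \<exists>\<eta>>0. \<forall>\<epsilon>. 0 < \<epsilon> \<and> \<epsilon> < \<eta> \<longrightarrow> X (scale_fun \<epsilon> \<phi>) \<in> K))"

definition gen_points_c :: "(real^'n::finite) set \<Rightarrow> ('n test_fun \<Rightarrow> real^'n) set set" where
  "gen_points_c \<Omega> = {\<xi> \<in> gen_points \<Omega>. \<exists>X\<in>\<xi>. compactly_supported_rep \<Omega> X}"

section \<open>Point values\<close>

definition eval_rep ::
    "(real^'n::finite) set \<Rightarrow> ('n test_fun \<Rightarrow> real^'n \<Rightarrow> complex) \<Rightarrow> ('n test_fun \<Rightarrow> real^'n) \<Rightarrow>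
      'n test_fun \<Rightarrow> complex" where
  "eval_rep \<Omega> R X = (\<lambda>\<phi>. if (\<phi>, X \<phi>) \<in> U_set \<Omega> then R \<phi> (X \<phi>) else 0)"

text \<open>The class of \<^term>\<open>eval_rep \<Omega> R X\<close>, lifted to classes by taking the union over all
  representatives \<open>R\<close> and all compactly supported representatives \<open>X\<close>; by well-definedness all
  the cosets in this union coincide.\<close>
definition point_value ::
    "(real^'n::finite) set \<Rightarrow> ('n test_fun \<Rightarrow> real^'n \<Rightarrow> complex) set \<Rightarrow>
      ('n test_fun \<Rightarrow> real^'n) set \<Rightarrow> ('n test_fun \<Rightarrow> complex) set" where
  "point_value \<Omega> F \<xi> =
     (\<Union>R\<in>F. \<Union>X\<in>{X \<in> \<xi>. compactly_supported_rep \<Omega> X}.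
        negligible_numbers +>\<^bsub>moderate_numbers_ring\<^esub> eval_rep \<Omega> R X)"

end

theory Submission
  imports Defs
begin

text \<open>
  Let \<open>R\<close> represent the given class. If \<open>R\<close> is negligible, its supremum over the compact set
  that carries a generalized point is smaller than every power of \<open>\<epsilon>\<close>, and so is its value
  at that point (\<open>eval_rep_negligible\<close>).

  For the converse two ideas are needed. First, a generalized point is an arbitrary function of
  the test function. Given a compact set \<open>K\<close>, one can therefore let it choose for each \<open>\<phi>\<close> a
  point of \<open>K\<close> where the modulus of \<open>R \<phi>\<close> is maximal (\<open>ex_maximizing_point\<close>). This point is
  compactly supported, and that its point value is negligible says precisely that the supremum
  of \<open>R\<close> over \<open>K\<close> is negligible. So the point values control \<open>R\<close> itself, without derivatives.

  Second, for moderate \<open>R\<close> the derivatives then follow: a first derivative is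
  controlled by the function and its second derivative, as in Landau's inequality. Since the
  second derivative grows at most like a fixed power of \<open>1/\<epsilon>\<close> and the function decays faster than
  any power of \<open>\<epsilon>\<close>, a Taylor step of suitable length shows that the first derivative also decays
  faster than any power (\<open>uniformly_negligible_partial_deriv\<close>). Induction on the order gives all
  derivatives (\<open>negligible_funs_if_order_zero\<close>).

  What remains is to pass to classes. A class is zero iff its representatives are negligible,
  since the negligible objects are closed under sums and differences; and a point value contains
  the values of all representatives, so that it can only be zero if these are negligible.
\<close>

section \<open>Partial derivatives of smooth functions\<close>

lemma eventually_line_in_open:
  fixes x v :: "'a::real_normed_vector"
  assumes "open S" "x \<in> S"
  shows "\<forall>\<^sub>F t::real in nhds 0. x + t *\<^sub>R v \<in> S"
proof -
  have "((\<lambda>t::real. x + t *\<^sub>R v) \<longlongrightarrow> x + 0 *\<^sub>R v) (nhds 0)"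
    by (intro tendsto_intros filterlim_ident)
  then show ?thesis
    using assms by (auto dest: topological_tendstoD)
qed

lemma partial_deriv_cong_open:
  assumes "open S" "x \<in> S" "\<And>y. y \<in> S \<Longrightarrow> f y = g y"
  shows "partial_deriv i f x = partial_deriv i g x"
proof -
  have "\<forall>\<^sub>F t::real in nhds 0. x + t *\<^sub>R axis i 1 \<in> S"
    using assms(1,2) by (rule eventually_line_in_open)
  then have "\<forall>\<^sub>F t::real in nhds 0. f (x + t *\<^sub>R axis i 1) = g (x + t *\<^sub>R axis i 1)"
    by eventually_elim (use assms(3) in blast)
  then show ?thesis
    unfolding partial_deriv_def
    by (intro vector_derivative_cong_eq) (auto elim: eventually_mono)
qed

lemma smooth_on_continuous_on: "smooth_on S f \<Longrightarrow> continuous_on S f"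
  unfolding smooth_on_def by (drule spec[of _ "[]"]) simp

lemma smooth_on_partial_deriv: "smooth_on S f \<Longrightarrow> smooth_on S (partial_deriv i f)"
proof -
  have "foldr partial_deriv is (partial_deriv i f) = foldr partial_deriv (is @ [i]) f" for "is"
    by simp
  moreover assume "smooth_on S f"
  ultimately show ?thesis
    unfolding smooth_on_def by presburger
qed

lemma smooth_on_foldr_partial_deriv: "smooth_on S f \<Longrightarrow> smooth_on S (foldr partial_deriv is f)"
  by (induction "is") (auto intro: smooth_on_partial_deriv)

lemma smooth_on_partial_deriv_funpow:
  "smooth_on S f \<Longrightarrow> smooth_on S ((partial_deriv i ^^ k) f)"
  by (induction k) (auto intro: smooth_on_partial_deriv)

lemma smooth_on_foldr_funpow:
  "smooth_on S f \<Longrightarrow> smooth_on S (foldr (\<lambda>i. partial_deriv i ^^ \<alpha> i) is f)"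
  by (induction "is") (auto intro: smooth_on_partial_deriv_funpow)

text \<open>The definition of smoothness differentiates along a coordinate line only at its base
  point; translating the parameter gives the derivative at every point of the line, as the
  one-dimensional Taylor estimate below requires.\<close>
lemma smooth_on_has_partial_deriv:
  assumes "smooth_on S f" "x + s *\<^sub>R axis i 1 \<in> S"
  shows "((\<lambda>t. f (x + t *\<^sub>R axis i 1)) has_vector_derivative
     partial_deriv i f (x + s *\<^sub>R axis i 1)) (at s)"
proof -
  let ?y = "x + s *\<^sub>R axis i 1"
  have "(\<lambda>t::real. f (?y + t *\<^sub>R axis i 1)) differentiable (at 0)"
    using assms unfolding smooth_on_def by (auto dest!: spec[of _ "[]"])
  then have "((\<lambda>t. f (?y + t *\<^sub>R axis i 1)) has_vector_derivative partial_deriv i f ?y) (at 0)"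
    unfolding partial_deriv_def by (simp add: vector_derivative_works)
  then have "((\<lambda>t. f (?y + t *\<^sub>R axis i 1)) has_vector_derivative partial_deriv i f ?y) (at (s - s))"
    by simp
  moreover have "((\<lambda>t::real. t - s) has_vector_derivative 1) (at s)"
    by (auto intro!: derivative_eq_intros)
  ultimately have "((\<lambda>t. f (?y + t *\<^sub>R axis i 1)) \<circ> (\<lambda>t. t - s)
     has_vector_derivative 1 *\<^sub>R partial_deriv i f ?y) (at s)"
    by (intro vector_diff_chain_at)
  then show ?thesis
    by (simp add: o_def algebra_simps flip: scaleR_add_left)
qed

lemma has_partial_derivI:
  assumes "((\<lambda>t. f (x + t *\<^sub>R axis i 1)) has_vector_derivative D) (at 0)"
  shows "partial_deriv i f x = D"
    and "(\<lambda>t. f (x + t *\<^sub>R axis i 1)) differentiable (at 0)"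
  using assms by (auto simp: partial_deriv_def vector_derivative_at
      intro: differentiableI_vector)

lemma foldr_partial_deriv_linear:
  assumes "open S" "smooth_on S f" "smooth_on S g" "x \<in> S"
  shows "foldr partial_deriv is (\<lambda>x. f x + c * g x) x =
     foldr partial_deriv is f x + c * foldr partial_deriv is g x"
  using assms(4)
proof (induction "is" arbitrary: x)
  case (Cons i "is")
  have sm: "smooth_on S (foldr partial_deriv is f)" "smooth_on S (foldr partial_deriv is g)"
    using assms(2,3) by (auto intro: smooth_on_foldr_partial_deriv)
  have "partial_deriv i (foldr partial_deriv is (\<lambda>x. f x + c * g x)) x =
      partial_deriv i (\<lambda>x. foldr partial_deriv is f x + c * foldr partial_deriv is g x) x"
    using Cons.prems by (intro partial_deriv_cong_open[OF assms(1)] Cons.IH)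
  also have "\<dots> = partial_deriv i (foldr partial_deriv is f) x
      + c * partial_deriv i (foldr partial_deriv is g) x"
    using smooth_on_has_partial_deriv[OF sm(1), of x 0 i]
      smooth_on_has_partial_deriv[OF sm(2), of x 0 i] Cons.prems
    by (intro has_partial_derivI(1) has_vector_derivative_add
        has_vector_derivative_mult_right) auto
  finally show ?case by simp
qed simp

lemma smooth_on_linear:
  assumes "open S" "smooth_on S f" "smooth_on S g"
  shows "smooth_on S (\<lambda>x. f x + c * g x)"
  unfolding smooth_on_def
proof (intro allI conjI ballI)
  fix "is" i x
  have sm: "smooth_on S (foldr partial_deriv is f)" "smooth_on S (foldr partial_deriv is g)" for "is"
    using assms(2,3) by (auto intro: smooth_on_foldr_partial_deriv)
  show "continuous_on S (foldr partial_deriv is (\<lambda>x. f x + c * g x))"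
    by (subst continuous_on_cong[OF refl foldr_partial_deriv_linear[OF assms]])
      (auto intro!: continuous_intros sm[THEN smooth_on_continuous_on])
  assume x: "x \<in> S"
  let ?h = "\<lambda>x. foldr partial_deriv is f x + c * foldr partial_deriv is g x"
  have "((\<lambda>t. ?h (x + t *\<^sub>R axis i 1)) has_vector_derivative
      partial_deriv i (foldr partial_deriv is f) x
      + c * partial_deriv i (foldr partial_deriv is g) x) (at 0)"
    using smooth_on_has_partial_deriv[OF sm(1), of x 0 i "is"]
      smooth_on_has_partial_deriv[OF sm(2), of x 0 i "is"] x
    by (intro has_vector_derivative_add has_vector_derivative_mult_right) auto
  moreover have "\<forall>\<^sub>F t::real in nhds 0. x + t *\<^sub>R axis i 1 \<in> S"
    using assms(1) x by (rule eventually_line_in_open)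
  then have "\<forall>\<^sub>F t::real in nhds 0. t \<in> UNIV \<longrightarrow> foldr partial_deriv is (\<lambda>x. f x + c * g x) (x + t *\<^sub>R axis i 1)
     = ?h (x + t *\<^sub>R axis i 1)"
    by eventually_elim (simp add: foldr_partial_deriv_linear[OF assms])
  ultimately have "((\<lambda>t. foldr partial_deriv is (\<lambda>x. f x + c * g x) (x + t *\<^sub>R axis i 1))
      has_vector_derivative partial_deriv i (foldr partial_deriv is f) x
      + c * partial_deriv i (foldr partial_deriv is g) x) (at 0)"
    using x by (subst has_vector_derivative_cong_ev) (auto simp: foldr_partial_deriv_linear[OF assms])
  then show "(\<lambda>t. foldr partial_deriv is (\<lambda>x. f x + c * g x) (x + t *\<^sub>R axis i 1))
      differentiable at 0"
    by (rule differentiableI_vector)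
qed

lemma foldr_partial_deriv_zero: "foldr partial_deriv is (\<lambda>_. 0) = (\<lambda>_. 0)"
  by (induction "is") (auto simp: partial_deriv_def)

lemma smooth_on_zero: "smooth_on S (\<lambda>_. 0)"
  by (simp add: smooth_on_def foldr_partial_deriv_zero)

text \<open>The two claims go together: each further derivative of the rescaled function is
  computed from the closed formula for the previous one, and that formula also shows that the
  next derivative exists.\<close>
lemma foldr_partial_deriv_scale:
  fixes f :: "real^'n::finite \<Rightarrow> complex"
  assumes "smooth_on UNIV f"
  shows "foldr partial_deriv is (\<lambda>y. c * f (a *\<^sub>R y)) =
     (\<lambda>y. c * complex_of_real (a ^ length is) * foldr partial_deriv is f (a *\<^sub>R y))"
    (is "?A is = ?B is")
    and "(\<lambda>t::real. foldr partial_deriv is (\<lambda>y. c * f (a *\<^sub>R y)) (x + t *\<^sub>R axis i 1))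
      differentiable at 0"
proof -
  have *: "((\<lambda>t::real. ?B is (x + t *\<^sub>R axis i 1)) has_vector_derivative ?B (i # is) x) (at 0)" for "is" i x
  proof -
    have sm: "smooth_on UNIV (foldr partial_deriv is f)"
      using assms by (rule smooth_on_foldr_partial_deriv)
    have "((\<lambda>t. foldr partial_deriv is f (a *\<^sub>R x + t *\<^sub>R axis i 1)) has_vector_derivative
        partial_deriv i (foldr partial_deriv is f) (a *\<^sub>R x)) (at (a * 0))"
      using smooth_on_has_partial_deriv[OF sm, of "a *\<^sub>R x" 0 i] by simp
    moreover have "((\<lambda>t::real. a * t) has_vector_derivative a) (at 0)"
      by (auto intro!: derivative_eq_intros)
    ultimately have "((\<lambda>t. foldr partial_deriv is f (a *\<^sub>R x + t *\<^sub>R axis i 1)) \<circ> (\<lambda>t. a * t)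
        has_vector_derivative a *\<^sub>R partial_deriv i (foldr partial_deriv is f) (a *\<^sub>R x)) (at 0)"
      by (intro vector_diff_chain_at)
    from has_vector_derivative_mult_right[OF this, of "c * complex_of_real (a ^ length is)"]
    show ?thesis
      by (simp add: o_def scaleR_add_right mult_ac scaleR_conv_of_real[where 'a=complex])
  qed
  have eq: "?A is = ?B is" for "is"
  proof (induction "is")
    case (Cons i "is")
    show ?case
      using has_partial_derivI(1)[where f = "?B is", OF *] Cons.IH by auto
  qed simp
  then show "?A is = ?B is" .
  show "(\<lambda>t::real. foldr partial_deriv is (\<lambda>y. c * f (a *\<^sub>R y)) (x + t *\<^sub>R axis i 1))
      differentiable at 0"
    unfolding eq by (rule has_partial_derivI(2)[where f = "?B is", OF *])
qed

lemma smooth_on_scale: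
  assumes "smooth_on UNIV f"
  shows "smooth_on UNIV (\<lambda>y. c * f (a *\<^sub>R y))"
  unfolding smooth_on_def
proof (intro allI conjI ballI)
  fix "is"
  have "smooth_on UNIV (foldr partial_deriv is f)"
    using assms by (rule smooth_on_foldr_partial_deriv)
  then have "continuous_on UNIV (foldr partial_deriv is f)"
    by (rule smooth_on_continuous_on)
  then show "continuous_on UNIV (foldr partial_deriv is (\<lambda>y. c * f (a *\<^sub>R y)))"
    unfolding foldr_partial_deriv_scale(1)[OF assms]
    by (intro continuous_intros continuous_on_compose2[of UNIV _ UNIV "\<lambda>y. a *\<^sub>R y"]) auto
qed (rule foldr_partial_deriv_scale(2)[OF assms])

lemma multi_deriv_eq_foldr:
  "multi_deriv \<alpha> = foldr partial_deriv (concat (map (\<lambda>i. replicate (\<alpha> i) i) index_list))"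
proof -
  have "foldr (\<lambda>i. partial_deriv i ^^ \<alpha> i) js f =
     foldr partial_deriv (concat (map (\<lambda>i. replicate (\<alpha> i) i) js)) f" for js and f :: "real^'a \<Rightarrow> complex"
  proof (induction js)
    case (Cons i js)
    have "foldr partial_deriv (replicate n i) g = (partial_deriv i ^^ n) g" for n and g :: "real^'a \<Rightarrow> complex"
      by (induction n) auto
    with Cons show ?case by simp
  qed simp
  then show ?thesis by (simp add: multi_deriv_def fun_eq_iff)
qed

lemma multi_deriv_linear:
  assumes "open S" "smooth_on S f" "smooth_on S g" "x \<in> S"
  shows "multi_deriv \<alpha> (\<lambda>x. f x + c * g x) x = multi_deriv \<alpha> f x + c * multi_deriv \<alpha> g x"
  unfolding multi_deriv_eq_foldr using foldr_partial_deriv_linear[OF assms] .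

lemma multi_deriv_zero_index: "multi_deriv (\<lambda>_. 0) f = f"
proof -
  have "foldr (\<lambda>i g. g) js f = f" for js :: "'a list" and f :: "real^'a \<Rightarrow> complex"
    by (induction js) auto
  then show ?thesis by (simp add: multi_deriv_def id_def)
qed

lemma index_list: "distinct (index_list :: 'n::finite list)" "set (index_list :: 'n list) = UNIV"
proof -
  have "\<exists>is :: 'n list. distinct is \<and> set is = UNIV"
    using finite_distinct_list[of "UNIV :: 'n set"] by auto
  from someI_ex[OF this] show "distinct (index_list :: 'n list)" "set (index_list :: 'n list) = UNIV"
    by (auto simp: index_list_def)
qed

text \<open>The derivative \<^term>\<open>multi_deriv \<alpha>\<close> applies the directions at the end of
  \<^term>\<open>index_list\<close> first. Hence as long as only the directions after \<open>i\<close> have been used, further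
  derivatives in direction \<open>i\<close> still give an expression of this form. Building up a multi-index
  from the end of the list in this way makes it possible to raise the order by one without
  interchanging partial derivatives.\<close>
lemma multi_deriv_suffix:
  assumes "index_list = js @ i # is"
  shows "(partial_deriv i ^^ k) (foldr (\<lambda>j. partial_deriv j ^^ \<alpha> j) is f) =
     multi_deriv (\<lambda>j. if j = i then k else if j \<in> set is then \<alpha> j else 0) f"
proof -
  define \<beta> where "\<beta> = (\<lambda>j. if j = i then k else if j \<in> set is then \<alpha> j else 0)"
  have d: "distinct (js @ i # is)"
    using index_list(1) assms by metis
  have "foldr (\<lambda>j. partial_deriv j ^^ \<beta> j) js g = g" for g :: "real^'a \<Rightarrow> complex"
  proof -
    have "\<forall>j\<in>set js. \<beta> j = 0"
      using d by (auto simp: \<beta>_def)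
    then show ?thesis by (induction js) auto
  qed
  moreover have "foldr (\<lambda>j. partial_deriv j ^^ \<beta> j) is f = foldr (\<lambda>j. partial_deriv j ^^ \<alpha> j) is f"
    using d by (intro foldr_cong) (auto simp: \<beta>_def)
  ultimately show ?thesis
    unfolding \<beta>_def[symmetric] multi_deriv_def assms by (simp add: \<beta>_def)
qed

text \<open>This is the Landau inequality before optimizing over \<open>h\<close>: if \<open>v\<close> is the derivative of \<open>u\<close>
  and \<open>M\<close> bounds the second derivative, then by Taylor's formula
  \<open>h * v 0\<close> differs from \<open>u h - u 0\<close> by at most \<open>M * h\<^sup>2\<close>.\<close>
lemma deriv_bound_from_second:
  fixes u :: "real \<Rightarrow> complex"
  assumes h: "0 < h"
    and v: "\<And>t. 0 \<le> t \<Longrightarrow> t \<le> h \<Longrightarrow> (u has_vector_derivative v t) (at t)"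
    and w: "\<And>t. 0 \<le> t \<Longrightarrow> t \<le> h \<Longrightarrow> (v has_vector_derivative w t) (at t)"
    and B: "cmod (u 0) \<le> B" "cmod (u h) \<le> B"
    and M: "\<And>t. 0 \<le> t \<Longrightarrow> t \<le> h \<Longrightarrow> cmod (w t) \<le> M"
  shows "cmod (v 0) \<le> 2 * B / h + M * h"
proof -
  have "0 \<le> M" using M[of 0] h by (auto intro: order_trans[OF norm_ge_zero])
  have "cmod (v t - v 0) \<le> M * h" if "t \<in> {0..h}" for t
  proof -
    have "cmod (v t - v 0) \<le> M * norm (t - 0)"
    proof (rule differentiable_bound[of "{0..h}"])
      fix x assume x: "x \<in> {0..h}"
      show "(v has_derivative (\<lambda>s. s *\<^sub>R w x)) (at x within {0..h})"
        using w[of x] x by (auto simp: has_vector_derivative_def intro: has_derivative_at_withinI)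
      show "onorm (\<lambda>s. s *\<^sub>R w x) \<le> M"
        using M[of x] x \<open>0 \<le> M\<close>
        by (intro onorm_bound) (auto simp: mult.commute[of M] intro: mult_left_mono)
    qed (use that h in auto)
    also have "\<dots> \<le> M * h"
      using that \<open>0 \<le> M\<close> by (intro mult_left_mono) auto
    finally show ?thesis .
  qed
  then have "cmod (u h - u 0 - (h - 0) *\<^sub>R v 0) \<le> norm (h - 0) * (M * h)"
    using h v
    by (intro vector_differentiable_bound_linearization[of "{0..h}"])
      (auto simp: closed_segment_eq_real_ivl intro: has_vector_derivative_at_within)
  then have "h * cmod (v 0) \<le> 2 * B + h * (M * h)"
    using B h norm_triangle_ineq4[of "u h - u 0" "u h - u 0 - h *\<^sub>R v 0"] norm_triangle_ineq4[of "u h" "u 0"]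
    by simp
  then show ?thesis
    using h by (simp add: field_simps)
qed

lemma partial_deriv_bound:
  assumes S: "smooth_on S f" and h: "0 < h"
    and seg: "\<And>t. 0 \<le> t \<Longrightarrow> t \<le> h \<Longrightarrow> x + t *\<^sub>R axis i 1 \<in> L" and L: "L \<subseteq> S"
    and B: "\<And>y. y \<in> L \<Longrightarrow> cmod (f y) \<le> B"
    and M: "\<And>y. y \<in> L \<Longrightarrow> cmod (partial_deriv i (partial_deriv i f) y) \<le> M"
  shows "cmod (partial_deriv i f x) \<le> 2 * B / h + M * h"
proof -
  have "cmod (partial_deriv i f (x + 0 *\<^sub>R axis i 1)) \<le> 2 * B / h + M * h"
    using seg[of 0] seg[of h] L h
    by (intro deriv_bound_from_second[where u="\<lambda>t. f (x + t *\<^sub>R axis i 1)"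
          and v="\<lambda>t. partial_deriv i f (x + t *\<^sub>R axis i 1)"
          and w="\<lambda>t. partial_deriv i (partial_deriv i f) (x + t *\<^sub>R axis i 1)"]
        smooth_on_has_partial_deriv[OF S] smooth_on_has_partial_deriv[OF smooth_on_partial_deriv[OF S]]
        h B M subsetD[OF L] seg) auto
  then show ?thesis by simp
qed

section \<open>Mollifiers and the domain of generalized functions\<close>

lemma mollifiers_max: "mollifiers (max p q) = mollifiers p \<inter> mollifiers q"
  by (auto simp: mollifiers_def le_max_iff_disj)

text \<open>The change of variables behind the fact that \<^term>\<open>scale_fun \<epsilon>\<close> preserves
  integrals.\<close>
lemma lborel_integral_scaleR:
  fixes f :: "'a::euclidean_space \<Rightarrow> complex"
  assumes "f \<in> borel_measurable borel" "0 < a"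
  shows "(LINT x|lborel. complex_of_real (a ^ DIM('a)) * f (a *\<^sub>R x)) = (LINT x|lborel. f x)"
proof -
  have "(LINT x|lborel. f x) =
      (LINT x|density (distr lborel borel (\<lambda>x. 0 + a *\<^sub>R x)) (\<lambda>_. ennreal (a ^ DIM('a))). f x)"
    using lborel_affine[of a "0 :: 'a"] assms(2) by (simp add: ennreal_power)
  also have "\<dots> = (LINT x|lborel. a ^ DIM('a) *\<^sub>R f (0 + a *\<^sub>R x))"
    using assms by (subst integral_density) (auto simp: integral_distr)
  finally show ?thesis
    by (simp add: scaleR_conv_of_real)
qed

lemma fun_supp_scale_fun:
  assumes "fun_supp \<phi> \<subseteq> cball 0 r" "0 < \<epsilon>"
  shows "fun_supp (scale_fun \<epsilon> \<phi>) \<subseteq> cball 0 (\<epsilon> * r)"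
  unfolding fun_supp_def
proof (intro closure_minimal subsetI)
  fix y assume "y \<in> {x. scale_fun \<epsilon> \<phi> x \<noteq> 0}"
  then have "inverse \<epsilon> *\<^sub>R y \<in> fun_supp \<phi>"
    unfolding fun_supp_def by (intro subsetD[OF closure_subset]) (auto simp: scale_fun_def)
  with assms show "y \<in> cball 0 (\<epsilon> * r)"
    by (auto simp: field_simps dest!: subsetD)
qed simp

lemma mollifier_supp_bounded:
  assumes "\<phi> \<in> mollifiers q"
  obtains r where "0 < r" "fun_supp \<phi> \<subseteq> cball 0 r"
proof -
  have "bounded (fun_supp \<phi>)"
    using assms by (auto simp: mollifiers_def test_functions_def intro: compact_imp_bounded)
  with that show thesis by (auto simp: bounded_pos subset_iff)
qed

lemma scale_fun_mollifier:
  assumes "\<phi> \<in> mollifiers q" "0 < \<epsilon>"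
  shows "scale_fun \<epsilon> \<phi> \<in> mollifiers 0"
proof -
  from assms have sm: "smooth_on UNIV \<phi>" and one: "(LINT x|lborel. \<phi> x) = 1"
    by (auto simp: mollifiers_def test_functions_def)
  obtain r where "fun_supp \<phi> \<subseteq> cball 0 r"
    using assms(1) by (rule mollifier_supp_bounded)
  then have "compact (fun_supp (scale_fun \<epsilon> \<phi>))"
    using fun_supp_scale_fun[of \<phi> r \<epsilon>] assms(2) bounded_subset[OF bounded_cball]
    by (auto simp: compact_eq_bounded_closed fun_supp_def)
  moreover have "smooth_on UNIV (scale_fun \<epsilon> \<phi>)"
    unfolding scale_fun_def by (rule smooth_on_scale[OF sm])
  moreover have "(LINT x|lborel. scale_fun \<epsilon> \<phi> x) = 1"
    using lborel_integral_scaleR[of \<phi> "inverse \<epsilon>"] assms(2) one smooth_on_continuous_on[OF sm]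
    by (simp add: scale_fun_def borel_measurable_continuous_onI power_inverse)
  ultimately show ?thesis
    unfolding mollifiers_def test_functions_def
    by (intro CollectI conjI allI impI) (assumption | linarith)+
qed

text \<open>The section of \<^term>\<open>U_set \<Omega>\<close> over \<open>\<phi>\<close>, i.e. the set on which a generalized
  function is smooth once its first argument is fixed to be \<open>\<phi>\<close>.\<close>
definition admissible_points :: "(real^'n::finite) set \<Rightarrow> 'n test_fun \<Rightarrow> (real^'n) set" where
  "admissible_points \<Omega> \<phi> = {x. (\<phi>, x) \<in> U_set \<Omega>}"

lemma open_admissible_points:
  assumes "open \<Omega>"
  shows "open (admissible_points \<Omega> \<phi>)"
proof (cases "\<phi> \<in> mollifiers 0")
  case True
  \<comment> \<open>The support translated by \<open>x\<close> leaves \<open>\<Omega>\<close> iff \<open>x\<close> is a point outside \<open>\<Omega>\<close> minus a point of the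
      support.\<close>
  let ?D = "\<Union>z\<in>-\<Omega>. \<Union>y\<in>fun_supp \<phi>. {z - y}"
  have "admissible_points \<Omega> \<phi> = \<Omega> \<inter> - ?D"
    using True by (auto simp: admissible_points_def U_set_def image_subset_iff add.commute)
      (metis Compl_iff add_diff_cancel_right')
  moreover have "closed ?D"
    using assms True by (intro closed_compact_differences)
      (auto simp: mollifiers_def test_functions_def)
  ultimately show ?thesis
    using assms by (metis open_Compl open_Int)
qed (auto simp: admissible_points_def U_set_def)

text \<open>The support of \<^term>\<open>scale_fun \<epsilon> \<phi>\<close> shrinks to the origin, so eventually its radius is
  smaller than the distance from \<open>K\<close> to the complement of \<open>\<Omega>\<close>. This is why the estimates on \<open>K\<close> only
  see values of a generalized function on \<^term>\<open>U_set \<Omega>\<close>.\<close>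
lemma eventually_compact_admissible:
  assumes "open \<Omega>" "compact K" "K \<subseteq> \<Omega>" "\<phi> \<in> mollifiers q"
  shows "\<forall>\<^sub>F \<epsilon> in at_right 0. K \<subseteq> admissible_points \<Omega> (scale_fun \<epsilon> \<phi>)"
proof -
  obtain r where r: "0 < r" "fun_supp \<phi> \<subseteq> cball 0 r"
    using assms(4) by (rule mollifier_supp_bounded)
  obtain d where d: "d > 0" "(\<Union>x\<in>K. cball x d) \<subseteq> \<Omega>"
    using compact_subset_open_imp_cball_epsilon_subset[OF assms(2,1,3)] .
  have "K \<subseteq> admissible_points \<Omega> (scale_fun \<epsilon> \<phi>)" if \<epsilon>: "0 < \<epsilon>" "\<epsilon> < d / r" for \<epsilon>
  proof
    fix x assume x: "x \<in> K"
    have "\<epsilon> * r < d" using \<epsilon> r by (simp add: field_simps)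
    have "y + x \<in> \<Omega>" if "y \<in> fun_supp (scale_fun \<epsilon> \<phi>)" for y
    proof -
      have "norm y \<le> d"
        using subsetD[OF fun_supp_scale_fun[OF r(2) \<epsilon>(1)] that] \<open>\<epsilon> * r < d\<close> by simp
      then have "y + x \<in> cball x d" by (simp add: dist_norm norm_minus_commute)
      then show ?thesis using d x by blast
    qed
    then show "x \<in> admissible_points \<Omega> (scale_fun \<epsilon> \<phi>)"
      using x assms(3) scale_fun_mollifier[OF assms(4) \<epsilon>(1)]
      by (auto simp: admissible_points_def U_set_def)
  qed
  then show ?thesis
    unfolding eventually_at_right_field using d r by (intro exI[of _ "d / r"]) auto
qed

section \<open>Uniform estimates on compact sets\<close>

text \<open>Weak and strict estimates are interchangeable because the constant may be doubled.\<close>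
lemma eps_bigo_SUP_iff:
  fixes h :: "real \<Rightarrow> 'a \<Rightarrow> real"
  assumes "\<And>\<epsilon>. 0 < \<epsilon> \<Longrightarrow> 0 < g \<epsilon>"
  shows "eps_bigo (\<lambda>\<epsilon>. SUP x\<in>K. ennreal (h \<epsilon> x)) g \<longleftrightarrow>
     (\<exists>C>0. \<forall>\<^sub>F \<epsilon> in at_right 0. \<forall>x\<in>K. h \<epsilon> x \<le> C * g \<epsilon>)" (is "?L \<longleftrightarrow> ?R")
proof
  assume ?L
  then obtain C e where C: "C > 0" "e > 0"
    "\<And>\<epsilon>. 0 < \<epsilon> \<Longrightarrow> \<epsilon> < e \<Longrightarrow> (SUP x\<in>K. ennreal (h \<epsilon> x)) < ennreal (C * \<bar>g \<epsilon>\<bar>)"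
    unfolding eps_bigo_def by blast
  have "h \<epsilon> x \<le> C * g \<epsilon>" if "0 < \<epsilon>" "\<epsilon> < e" "x \<in> K" for \<epsilon> x
  proof -
    have "ennreal (h \<epsilon> x) < ennreal (C * \<bar>g \<epsilon>\<bar>)"
      using C(3)[OF that(1,2)] SUP_upper[OF that(3), of "\<lambda>x. ennreal (h \<epsilon> x)"]
      by (rule le_less_trans[rotated])
    then have "h \<epsilon> x < C * \<bar>g \<epsilon>\<bar>"
      using C(1) by (metis ennreal_leI not_le)
    with assms[OF that(1)] show ?thesis by simp
  qed
  with C(1,2) show ?R
    unfolding eventually_at_right_field by blast
next
  assume ?R
  then obtain C e where C: "C > 0" "e > 0"
    "\<And>\<epsilon> x. 0 < \<epsilon> \<Longrightarrow> \<epsilon> < e \<Longrightarrow> x \<in> K \<Longrightarrow> h \<epsilon> x \<le> C * g \<epsilon>"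
    unfolding eventually_at_right_field by blast
  have "(SUP x\<in>K. ennreal (h \<epsilon> x)) < ennreal (2 * C * \<bar>g \<epsilon>\<bar>)" if "0 < \<epsilon>" "\<epsilon> < e" for \<epsilon>
  proof -
    have "(SUP x\<in>K. ennreal (h \<epsilon> x)) \<le> ennreal (C * g \<epsilon>)"
      using C(3)[OF that] by (intro SUP_least ennreal_leI)
    also have "\<dots> < ennreal (2 * C * \<bar>g \<epsilon>\<bar>)"
      using C(1) assms[OF that(1)] by (intro ennreal_lessI) auto
    finally show ?thesis .
  qed
  with C(1,2) show ?L
    unfolding eps_bigo_def by (intro exI[of _ "2 * C"]) auto
qed

lemma eps_bigo_iff:
  assumes "\<And>\<epsilon>. 0 < \<epsilon> \<Longrightarrow> 0 < g \<epsilon>"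
  shows "eps_bigo (\<lambda>\<epsilon>. ennreal (h \<epsilon>)) g \<longleftrightarrow> (\<exists>C>0. \<forall>\<^sub>F \<epsilon> in at_right 0. h \<epsilon> \<le> C * g \<epsilon>)"
  using eps_bigo_SUP_iff[where K = "{()}" and h = "\<lambda>\<epsilon> _. h \<epsilon>", OF assms] by simp

text \<open>The next two predicates are the growth conditions without derivatives. Stating them for an
  arbitrary family \<open>G\<close> makes it possible to apply them to the derivatives of a generalized
  function one at a time.\<close>
definition uniformly_moderate ::
    "(real^'n::finite) set \<Rightarrow> ('n test_fun \<Rightarrow> real^'n \<Rightarrow> complex) \<Rightarrow> bool" where
  "uniformly_moderate \<Omega> G \<longleftrightarrow> (\<forall>K. compact K \<and> K \<subseteq> \<Omega> \<longrightarrow> (\<exists>N\<ge>1. \<forall>\<phi>\<in>mollifiers N.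
     \<exists>C>0. \<forall>\<^sub>F \<epsilon> in at_right 0. \<forall>x\<in>K. cmod (G (scale_fun \<epsilon> \<phi>) x) \<le> C * inverse (\<epsilon> ^ N)))"

definition uniformly_negligible ::
    "(real^'n::finite) set \<Rightarrow> ('n test_fun \<Rightarrow> real^'n \<Rightarrow> complex) \<Rightarrow> bool" where
  "uniformly_negligible \<Omega> G \<longleftrightarrow>
    (\<forall>K. compact K \<and> K \<subseteq> \<Omega> \<longrightarrow> (\<forall>m\<ge>1. \<exists>q\<ge>1. \<forall>\<phi>\<in>mollifiers q.
     \<exists>C>0. \<forall>\<^sub>F \<epsilon> in at_right 0. \<forall>x\<in>K. cmod (G (scale_fun \<epsilon> \<phi>) x) \<le> C * \<epsilon> ^ m))"

lemma basic_space_iff: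
  "R \<in> basic_space \<Omega> \<longleftrightarrow> (\<forall>\<phi>\<in>mollifiers 0. smooth_on (admissible_points \<Omega> \<phi>) (R \<phi>))"
  by (simp add: basic_space_def admissible_points_def)

lemma moderate_iff:
  "R \<in> moderate \<Omega> \<longleftrightarrow>
     R \<in> basic_space \<Omega> \<and> (\<forall>\<alpha>. uniformly_moderate \<Omega> (\<lambda>\<phi>. multi_deriv \<alpha> (R \<phi>)))"
  unfolding moderate_def uniformly_moderate_def
  by (subst eps_bigo_SUP_iff) auto

lemma negligible_funs_iff:
  "R \<in> negligible_funs \<Omega> \<longleftrightarrow>
     R \<in> basic_space \<Omega> \<and> (\<forall>\<alpha>. uniformly_negligible \<Omega> (\<lambda>\<phi>. multi_deriv \<alpha> (R \<phi>)))"
  unfolding negligible_funs_def uniformly_negligible_def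
  by (subst eps_bigo_SUP_iff) auto

lemma negligible_numbers_iff:
  "r \<in> negligible_numbers \<longleftrightarrow> (\<forall>m\<ge>1. \<exists>q\<ge>1. \<forall>\<phi>\<in>mollifiers q.
     \<exists>C>0. \<forall>\<^sub>F \<epsilon> in at_right 0. cmod (r (scale_fun \<epsilon> \<phi>)) \<le> C * \<epsilon> ^ m)"
  unfolding negligible_numbers_def by (subst eps_bigo_iff) auto

lemma zero_negligible_numbers: "(\<lambda>_. 0) \<in> negligible_numbers"
  unfolding negligible_numbers_iff
  by (auto intro!: exI[of _ 1] simp: eventually_at_right_field)

lemma negligible_numbers_linear:
  assumes "r \<in> negligible_numbers" "s \<in> negligible_numbers"
  shows "(\<lambda>\<phi>. r \<phi> + c * s \<phi>) \<in> negligible_numbers"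
  unfolding negligible_numbers_iff
proof (intro allI impI)
  fix m :: nat assume "1 \<le> m"
  with assms(1) obtain p where p: "1 \<le> p" "\<forall>\<phi>\<in>mollifiers p.
     \<exists>C>0. \<forall>\<^sub>F \<epsilon> in at_right 0. cmod (r (scale_fun \<epsilon> \<phi>)) \<le> C * \<epsilon> ^ m"
    unfolding negligible_numbers_iff by blast
  from assms(2) \<open>1 \<le> m\<close> obtain q where q: "1 \<le> q" "\<forall>\<phi>\<in>mollifiers q.
     \<exists>C>0. \<forall>\<^sub>F \<epsilon> in at_right 0. cmod (s (scale_fun \<epsilon> \<phi>)) \<le> C * \<epsilon> ^ m"
    unfolding negligible_numbers_iff by blast
  show "\<exists>q\<ge>1. \<forall>\<phi>\<in>mollifiers q. \<exists>C>0. \<forall>\<^sub>F \<epsilon> in at_right 0.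
      cmod (r (scale_fun \<epsilon> \<phi>) + c * s (scale_fun \<epsilon> \<phi>)) \<le> C * \<epsilon> ^ m"
  proof (intro exI[of _ "max p q"] conjI ballI)
    fix \<phi> :: "'a test_fun" assume "\<phi> \<in> mollifiers (max p q)"
    then have "\<phi> \<in> mollifiers p" "\<phi> \<in> mollifiers q"
      by (simp_all add: mollifiers_max)
    with p q obtain C D where C: "C > 0" "\<forall>\<^sub>F \<epsilon> in at_right 0. cmod (r (scale_fun \<epsilon> \<phi>)) \<le> C * \<epsilon> ^ m"
      and D: "D > 0" "\<forall>\<^sub>F \<epsilon> in at_right 0. cmod (s (scale_fun \<epsilon> \<phi>)) \<le> D * \<epsilon> ^ m"
      by blast
    have "\<forall>\<^sub>F \<epsilon> in at_right 0.
        cmod (r (scale_fun \<epsilon> \<phi>) + c * s (scale_fun \<epsilon> \<phi>)) \<le> (C + cmod c * D) * \<epsilon> ^ m"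
      using C(2) D(2)
    proof eventually_elim
      case (elim \<epsilon>)
      have "cmod (c * s (scale_fun \<epsilon> \<phi>)) \<le> cmod c * (D * \<epsilon> ^ m)"
        using elim(2) by (simp add: norm_mult mult_left_mono)
      with elim(1) show ?case
        by (intro norm_triangle_le) (simp add: algebra_simps)
    qed
    moreover have "C + cmod c * D > 0" using C(1) D(1) by (simp add: add_pos_nonneg)
    ultimately show "\<exists>C>0. \<forall>\<^sub>F \<epsilon> in at_right 0.
      cmod (r (scale_fun \<epsilon> \<phi>) + c * s (scale_fun \<epsilon> \<phi>)) \<le> C * \<epsilon> ^ m" by blast
  qed (use p in auto)
qed

lemma zero_negligible_funs: "(\<lambda>_ _. 0) \<in> negligible_funs \<Omega>"
  unfolding negligible_funs_iff basic_space_iff uniformly_negligible_def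
  by (auto intro!: exI[of _ 1] simp: eventually_at_right_field smooth_on_zero
      multi_deriv_eq_foldr foldr_partial_deriv_zero)

lemma negligible_funs_linear:
  assumes \<Omega>: "open \<Omega>" and RS: "R \<in> negligible_funs \<Omega>" "S \<in> negligible_funs \<Omega>"
  shows "(\<lambda>\<phi> x. R \<phi> x + c * S \<phi> x) \<in> negligible_funs \<Omega>"
  unfolding negligible_funs_iff
proof (intro conjI allI)
  have sm: "smooth_on (admissible_points \<Omega> \<phi>) (R \<phi>)" "smooth_on (admissible_points \<Omega> \<phi>) (S \<phi>)"
    if "\<phi> \<in> mollifiers 0" for \<phi>
    using RS that by (auto simp: negligible_funs_iff basic_space_iff)
  show "(\<lambda>\<phi> x. R \<phi> x + c * S \<phi> x) \<in> basic_space \<Omega>"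
    unfolding basic_space_iff
    by (auto intro!: smooth_on_linear open_admissible_points[OF \<Omega>] sm)
  fix \<alpha>
  have neg: "uniformly_negligible \<Omega> (\<lambda>\<phi>. multi_deriv \<alpha> (R \<phi>))"
    "uniformly_negligible \<Omega> (\<lambda>\<phi>. multi_deriv \<alpha> (S \<phi>))"
    using RS by (auto simp: negligible_funs_iff)
  show "uniformly_negligible \<Omega> (\<lambda>\<phi>. multi_deriv \<alpha> (\<lambda>x. R \<phi> x + c * S \<phi> x))"
    unfolding uniformly_negligible_def
  proof (intro allI impI)
    fix K and m :: nat assume K: "compact K \<and> K \<subseteq> \<Omega>" and m: "1 \<le> m"
    obtain p where p: "1 \<le> p" "\<forall>\<phi>\<in>mollifiers p. \<exists>C>0. \<forall>\<^sub>F \<epsilon> in at_right 0.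
        \<forall>x\<in>K. cmod (multi_deriv \<alpha> (R (scale_fun \<epsilon> \<phi>)) x) \<le> C * \<epsilon> ^ m"
      using neg(1) K m unfolding uniformly_negligible_def by blast
    obtain q where q: "1 \<le> q" "\<forall>\<phi>\<in>mollifiers q. \<exists>C>0. \<forall>\<^sub>F \<epsilon> in at_right 0.
        \<forall>x\<in>K. cmod (multi_deriv \<alpha> (S (scale_fun \<epsilon> \<phi>)) x) \<le> C * \<epsilon> ^ m"
      using neg(2) K m unfolding uniformly_negligible_def by blast
    show "\<exists>q\<ge>1. \<forall>\<phi>\<in>mollifiers q. \<exists>C>0. \<forall>\<^sub>F \<epsilon> in at_right 0. \<forall>x\<in>K.
        cmod (multi_deriv \<alpha> (\<lambda>x. R (scale_fun \<epsilon> \<phi>) x + c * S (scale_fun \<epsilon> \<phi>) x) x) \<le> C * \<epsilon> ^ m"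
    proof (intro exI[of _ "max p q"] conjI ballI)
      fix \<phi> :: "'a test_fun" assume \<phi>: "\<phi> \<in> mollifiers (max p q)"
      then have "\<phi> \<in> mollifiers p" "\<phi> \<in> mollifiers q"
        by (simp_all add: mollifiers_max)
      with p q obtain C D where C: "C > 0" "\<forall>\<^sub>F \<epsilon> in at_right 0.
          \<forall>x\<in>K. cmod (multi_deriv \<alpha> (R (scale_fun \<epsilon> \<phi>)) x) \<le> C * \<epsilon> ^ m"
        and D: "D > 0" "\<forall>\<^sub>F \<epsilon> in at_right 0.
          \<forall>x\<in>K. cmod (multi_deriv \<alpha> (S (scale_fun \<epsilon> \<phi>)) x) \<le> D * \<epsilon> ^ m"
        by blast
      have "\<forall>\<^sub>F \<epsilon> in at_right 0. \<forall>x\<in>K.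
        cmod (multi_deriv \<alpha> (\<lambda>x. R (scale_fun \<epsilon> \<phi>) x + c * S (scale_fun \<epsilon> \<phi>) x) x)
          \<le> (C + cmod c * D) * \<epsilon> ^ m"
        using C(2) D(2) eventually_compact_admissible[OF \<Omega> conjunct1[OF K] conjunct2[OF K] \<phi>]
          eventually_at_right_less[of 0]
      proof eventually_elim
        case (elim \<epsilon>)
        show ?case
        proof
          fix x assume x: "x \<in> K"
          let ?\<psi> = "scale_fun \<epsilon> \<phi>"
          have \<psi>: "?\<psi> \<in> mollifiers 0" using \<phi> elim by (intro scale_fun_mollifier)
          have "cmod (c * multi_deriv \<alpha> (S ?\<psi>) x) \<le> cmod c * (D * \<epsilon> ^ m)"
            using elim x by (simp add: norm_mult mult_left_mono)
          moreover have "cmod (multi_deriv \<alpha> (R ?\<psi>) x) \<le> C * \<epsilon> ^ m"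
            using elim x by blast
          moreover have "multi_deriv \<alpha> (\<lambda>x. R ?\<psi> x + c * S ?\<psi> x) x =
              multi_deriv \<alpha> (R ?\<psi>) x + c * multi_deriv \<alpha> (S ?\<psi>) x"
            using elim x by (intro multi_deriv_linear[OF open_admissible_points[OF \<Omega>] sm[OF \<psi>]]) blast
          ultimately show "cmod (multi_deriv \<alpha> (\<lambda>x. R ?\<psi> x + c * S ?\<psi> x) x)
              \<le> (C + cmod c * D) * \<epsilon> ^ m"
            using norm_triangle_ineq[of "multi_deriv \<alpha> (R ?\<psi>) x" "c * multi_deriv \<alpha> (S ?\<psi>) x"]
            by (simp add: algebra_simps)
        qed
      qed
      moreover have "C + cmod c * D > 0" using C(1) D(1) by (simp add: add_pos_nonneg)
      ultimately show "\<exists>C>0. \<forall>\<^sub>F \<epsilon> in at_right 0. \<forall>x\<in>K.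
        cmod (multi_deriv \<alpha> (\<lambda>x. R (scale_fun \<epsilon> \<phi>) x + c * S (scale_fun \<epsilon> \<phi>) x) x) \<le> C * \<epsilon> ^ m"
        by blast
    qed (use p in auto)
  qed
qed

section \<open>Derivative estimates from estimates of order zero\<close>

text \<open>By the inequality above, a derivative is bounded by \<open>2 * B / h + M * h\<close>, where \<open>B\<close>
  bounds the function and \<open>M\<close> the second derivative on a slightly larger compact set. Moderateness
  gives \<open>M = O(\<epsilon>\<^sup>-\<^sup>N)\<close> with a fixed \<open>N\<close>, whereas \<open>B\<close> is smaller than any power of \<open>\<epsilon>\<close>. With
  \<open>h = \<epsilon>\<^bsup>m + N\<^esup>\<close> and \<open>B = O(\<epsilon>\<^bsup>2m + N\<^esup>)\<close> both summands are \<open>O(\<epsilon>\<^sup>m)\<close>.\<close>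
lemma uniformly_negligible_partial_deriv:
  assumes \<Omega>: "open \<Omega>"
    and sm: "\<And>\<phi>. \<phi> \<in> mollifiers 0 \<Longrightarrow> smooth_on (admissible_points \<Omega> \<phi>) (G \<phi>)"
    and neg: "uniformly_negligible \<Omega> G"
    and mod: "uniformly_moderate \<Omega> (\<lambda>\<phi>. partial_deriv i (partial_deriv i (G \<phi>)))"
  shows "uniformly_negligible \<Omega> (\<lambda>\<phi>. partial_deriv i (G \<phi>))"
  unfolding uniformly_negligible_def
proof (intro allI impI)
  fix K and m :: nat assume K: "compact K \<and> K \<subseteq> \<Omega>" and m: "1 \<le> m"
  obtain d where d: "d > 0" "(\<Union>x\<in>K. cball x d) \<subseteq> \<Omega>"
    using compact_subset_open_imp_cball_epsilon_subset[of K \<Omega>] K \<Omega> by auto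
  define L where "L = {x + y |x y. x \<in> K \<and> y \<in> cball 0 d}"
  have L: "compact L" "L \<subseteq> \<Omega>"
  proof -
    show "compact L"
      unfolding L_def using K by (intro compact_sums) auto
    show "L \<subseteq> \<Omega>"
    proof
      fix z assume "z \<in> L"
      then obtain x y where "z = x + y" "x \<in> K" "norm y \<le> d"
        by (auto simp: L_def)
      then have "z \<in> cball x d" by (simp add: dist_norm)
      with \<open>x \<in> K\<close> d show "z \<in> \<Omega>" by blast
    qed
  qed
  obtain N where N: "1 \<le> N" "\<forall>\<phi>\<in>mollifiers N. \<exists>C>0. \<forall>\<^sub>F \<epsilon> in at_right 0. \<forall>x\<in>L.
      cmod (partial_deriv i (partial_deriv i (G (scale_fun \<epsilon> \<phi>))) x) \<le> C * inverse (\<epsilon> ^ N)"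
    using mod L unfolding uniformly_moderate_def by blast
  have "1 \<le> 2 * m + N" using m by simp
  then obtain p where p: "1 \<le> p" "\<forall>\<phi>\<in>mollifiers p. \<exists>C>0. \<forall>\<^sub>F \<epsilon> in at_right 0. \<forall>x\<in>L.
      cmod (G (scale_fun \<epsilon> \<phi>) x) \<le> C * \<epsilon> ^ (2 * m + N)"
    using neg L unfolding uniformly_negligible_def by blast
  show "\<exists>q\<ge>1. \<forall>\<phi>\<in>mollifiers q. \<exists>C>0. \<forall>\<^sub>F \<epsilon> in at_right 0. \<forall>x\<in>K.
      cmod (partial_deriv i (G (scale_fun \<epsilon> \<phi>)) x) \<le> C * \<epsilon> ^ m"
  proof (intro exI[of _ "max N p"] conjI ballI)
    fix \<phi> :: "'a test_fun" assume \<phi>: "\<phi> \<in> mollifiers (max N p)"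
    then have "\<phi> \<in> mollifiers N" "\<phi> \<in> mollifiers p"
      by (simp_all add: mollifiers_max)
    with N p obtain A B where A: "A > 0" "\<forall>\<^sub>F \<epsilon> in at_right 0. \<forall>x\<in>L.
      cmod (partial_deriv i (partial_deriv i (G (scale_fun \<epsilon> \<phi>))) x) \<le> A * inverse (\<epsilon> ^ N)"
      and B: "B > 0" "\<forall>\<^sub>F \<epsilon> in at_right 0. \<forall>x\<in>L.
      cmod (G (scale_fun \<epsilon> \<phi>) x) \<le> B * \<epsilon> ^ (2 * m + N)"
      by blast
    have "\<forall>\<^sub>F \<epsilon> in at_right 0. \<epsilon> < min 1 d"
      unfolding eventually_at_right_field using d by (intro exI[of _ "min 1 d"]) auto
    then have "\<forall>\<^sub>F \<epsilon> in at_right 0. \<forall>x\<in>K.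
      cmod (partial_deriv i (G (scale_fun \<epsilon> \<phi>)) x) \<le> (2 * B + A) * \<epsilon> ^ m"
      using A(2) B(2) eventually_compact_admissible[OF \<Omega> L \<phi>] eventually_at_right_less[of 0]
    proof eventually_elim
      case (elim \<epsilon>)
      show ?case
      proof
        fix x assume x: "x \<in> K"
        define h where "h = \<epsilon> ^ (m + N)"
        \<comment> \<open>A step of length at most \<open>\<epsilon>\<close> from \<open>x\<close> does not leave the enlarged compact set.\<close>
        have h: "0 < h" "h \<le> d"
        proof -
          show "0 < h" using elim by (simp add: h_def)
          have "\<epsilon> ^ (m + N) \<le> \<epsilon> ^ 1"
            using elim m by (intro power_decreasing) auto
          with elim show "h \<le> d" by (simp add: h_def)
        qed
        have seg: "x + t *\<^sub>R axis i 1 \<in> L" if "0 \<le> t" "t \<le> h" for t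
          unfolding L_def using that h x
          by (intro CollectI exI[of _ x] exI[of _ "t *\<^sub>R axis i 1"]) (simp add: norm_axis_1)
        have "cmod (partial_deriv i (G (scale_fun \<epsilon> \<phi>)) x)
            \<le> 2 * (B * \<epsilon> ^ (2 * m + N)) / h + (A * inverse (\<epsilon> ^ N)) * h"
        proof (rule partial_deriv_bound[where L = L])
          show "smooth_on (admissible_points \<Omega> (scale_fun \<epsilon> \<phi>)) (G (scale_fun \<epsilon> \<phi>))"
            using elim \<phi> by (intro sm scale_fun_mollifier)
        qed (use elim h seg in auto)
        also have "\<dots> = (2 * B + A) * \<epsilon> ^ m"
        proof -
          have "\<epsilon> ^ (2 * m + N) = \<epsilon> ^ m * h" "h = \<epsilon> ^ m * \<epsilon> ^ N"
            by (simp_all add: h_def mult_2 add_ac flip: power_add)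
          moreover have "\<epsilon> \<noteq> 0" using elim by simp
          ultimately show ?thesis using h(1) by (simp add: field_simps)
        qed
        finally show "cmod (partial_deriv i (G (scale_fun \<epsilon> \<phi>)) x) \<le> (2 * B + A) * \<epsilon> ^ m" .
      qed
    qed
    moreover have "2 * B + A > 0" using A(1) B(1) by simp
    ultimately show "\<exists>C>0. \<forall>\<^sub>F \<epsilon> in at_right 0. \<forall>x\<in>K.
      cmod (partial_deriv i (G (scale_fun \<epsilon> \<phi>)) x) \<le> C * \<epsilon> ^ m" by blast
  qed (use N in auto)
qed

text \<open>The previous lemma raises the order of the derivative by one. The induction runs over
  the final segments of \<^term>\<open>index_list\<close>, and for each new direction \<open>i\<close> over the number of
  derivatives in that direction.\<close>
lemma negligible_funs_if_order_zero:
  assumes \<Omega>: "open \<Omega>" and R: "R \<in> moderate \<Omega>" and neg: "uniformly_negligible \<Omega> R"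
  shows "R \<in> negligible_funs \<Omega>"
  unfolding negligible_funs_iff
proof (intro conjI allI)
  show basic: "R \<in> basic_space \<Omega>" using R by (simp add: moderate_iff)
  fix \<alpha>
  have "uniformly_negligible \<Omega> (\<lambda>\<phi>. foldr (\<lambda>j. partial_deriv j ^^ \<alpha> j) is (R \<phi>))"
    if "index_list = js @ is" for js "is"
    using that
  proof (induction "is" arbitrary: js)
    case Nil
    then show ?case using neg by simp
  next
    case (Cons i "is")
    define G where
      "G = (\<lambda>k \<phi>. (partial_deriv i ^^ k) (foldr (\<lambda>j. partial_deriv j ^^ \<alpha> j) is (R \<phi>)))"
    have "uniformly_negligible \<Omega> (G k)" for k
    proof (induction k)
      case 0
      show ?case using Cons.IH[of "js @ [i]"] Cons.prems by (simp add: G_def)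
    next
      case (Suc k)
      have "uniformly_moderate \<Omega> (G (Suc (Suc k)))"
        unfolding G_def multi_deriv_suffix[OF Cons.prems] using R by (simp add: moderate_iff)
      moreover have "smooth_on (admissible_points \<Omega> \<phi>) (G k \<phi>)" if "\<phi> \<in> mollifiers 0" for \<phi>
        unfolding G_def using basic that
        by (auto simp: basic_space_iff intro!: smooth_on_partial_deriv_funpow smooth_on_foldr_funpow)
      ultimately have "uniformly_negligible \<Omega> (\<lambda>\<phi>. partial_deriv i (G k \<phi>))"
        using Suc by (intro uniformly_negligible_partial_deriv[OF \<Omega>]) (simp_all add: G_def)
      then show ?case by (simp add: G_def)
    qed
    from this[of "\<alpha> i"] show ?case by (simp add: G_def)
  qed
  from this[of "[]" index_list] show "uniformly_negligible \<Omega> (\<lambda>\<phi>. multi_deriv \<alpha> (R \<phi>))"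
    by (simp add: multi_deriv_def)
qed

section \<open>Point values\<close>

text \<open>A compactly supported point eventually takes values in a compact set, so the uniform
  estimate of order zero there applies. Passing to the larger of the two mollifier orders makes
  both properties available.\<close>
lemma eval_rep_negligible:
  assumes R: "R \<in> negligible_funs \<Omega>" and X: "compactly_supported_rep \<Omega> X"
  shows "eval_rep \<Omega> R X \<in> negligible_numbers"
  unfolding negligible_numbers_iff
proof (intro allI impI)
  fix m :: nat assume m: "1 \<le> m"
  obtain K N where K: "compact K" "K \<subseteq> \<Omega>" and N: "1 \<le> N" "\<forall>\<phi>\<in>mollifiers N.
      \<exists>\<eta>>0. \<forall>\<epsilon>. 0 < \<epsilon> \<and> \<epsilon> < \<eta> \<longrightarrow> X (scale_fun \<epsilon> \<phi>) \<in> K"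
    using X unfolding compactly_supported_rep_def by blast
  have "uniformly_negligible \<Omega> (\<lambda>\<phi>. multi_deriv (\<lambda>_. 0) (R \<phi>))"
    using R unfolding negligible_funs_iff by blast
  then obtain p where p: "1 \<le> p" "\<forall>\<phi>\<in>mollifiers p. \<exists>C>0. \<forall>\<^sub>F \<epsilon> in at_right 0. \<forall>x\<in>K.
      cmod (R (scale_fun \<epsilon> \<phi>) x) \<le> C * \<epsilon> ^ m"
    using K m unfolding uniformly_negligible_def multi_deriv_zero_index by blast
  show "\<exists>q\<ge>1. \<forall>\<phi>\<in>mollifiers q. \<exists>C>0. \<forall>\<^sub>F \<epsilon> in at_right 0.
      cmod (eval_rep \<Omega> R X (scale_fun \<epsilon> \<phi>)) \<le> C * \<epsilon> ^ m"
  proof (intro exI[of _ "max N p"] conjI ballI)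
    fix \<phi> :: "'a test_fun" assume "\<phi> \<in> mollifiers (max N p)"
    then have "\<phi> \<in> mollifiers N" "\<phi> \<in> mollifiers p"
      by (simp_all add: mollifiers_max)
    with N p obtain C where C: "C > 0" "\<forall>\<^sub>F \<epsilon> in at_right 0. \<forall>x\<in>K.
      cmod (R (scale_fun \<epsilon> \<phi>) x) \<le> C * \<epsilon> ^ m"
      and X: "\<exists>\<eta>>0. \<forall>\<epsilon>. 0 < \<epsilon> \<and> \<epsilon> < \<eta> \<longrightarrow> X (scale_fun \<epsilon> \<phi>) \<in> K"
      by blast
    from X have "\<forall>\<^sub>F \<epsilon> in at_right 0. X (scale_fun \<epsilon> \<phi>) \<in> K"
      unfolding eventually_at_right_field by auto
    with C(2) eventually_at_right_less[of 0]
    have "\<forall>\<^sub>F \<epsilon> in at_right 0. cmod (eval_rep \<Omega> R X (scale_fun \<epsilon> \<phi>)) \<le> C * \<epsilon> ^ m"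
      by eventually_elim (use C(1) in \<open>auto simp: eval_rep_def\<close>)
    with C(1) show "\<exists>C>0. \<forall>\<^sub>F \<epsilon> in at_right 0.
      cmod (eval_rep \<Omega> R X (scale_fun \<epsilon> \<phi>)) \<le> C * \<epsilon> ^ m" by blast
  qed (use N in auto)
qed

text \<open>A generalized point may depend on the test function in an arbitrary way. So for
  every \<open>\<phi>\<close> such that \<open>R \<phi>\<close> is continuous on \<open>K\<close> one can pick a point at which \<^term>\<open>\<lambda>x. cmod (R \<phi> x)\<close> attains its maximum over \<open>K\<close>,
  and the modulus of the point value is the supremum over \<open>K\<close>. A single generalized point thus
  carries the estimates for all \<open>\<phi>\<close> and \<open>\<epsilon>\<close>.\<close>
lemma ex_maximizing_point:
  assumes \<Omega>: "open \<Omega>" and R: "R \<in> basic_space \<Omega>" and K: "compact K" "K \<subseteq> \<Omega>" "K \<noteq> {}"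
  obtains X where "X \<in> point_reps \<Omega>" "compactly_supported_rep \<Omega> X"
    "\<And>\<phi>. K \<subseteq> admissible_points \<Omega> \<phi> \<Longrightarrow> X \<phi> \<in> K \<and> (\<forall>x\<in>K. cmod (R \<phi> x) \<le> cmod (R \<phi> (X \<phi>)))"
proof -
  have "\<exists>y\<in>K. K \<subseteq> admissible_points \<Omega> \<phi> \<longrightarrow> (\<forall>x\<in>K. cmod (R \<phi> x) \<le> cmod (R \<phi> y))" for \<phi>
  proof (cases "K \<subseteq> admissible_points \<Omega> \<phi>")
    case True
    with K(3) have "\<phi> \<in> mollifiers 0"
      by (auto simp: admissible_points_def U_set_def)
    then have "continuous_on (admissible_points \<Omega> \<phi>) (R \<phi>)"
      using R by (auto simp: basic_space_iff intro: smooth_on_continuous_on)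
    then have "continuous_on K (\<lambda>x. cmod (R \<phi> x))"
      using True by (intro continuous_on_norm) (rule continuous_on_subset)
    then show ?thesis
      using continuous_attains_sup[OF K(1,3)] by blast
  qed (use K in auto)
  then obtain X where X: "\<And>\<phi>. X \<phi> \<in> K"
    "\<And>\<phi>. K \<subseteq> admissible_points \<Omega> \<phi> \<Longrightarrow> \<forall>x\<in>K. cmod (R \<phi> x) \<le> cmod (R \<phi> (X \<phi>))"
    by metis
  \<comment> \<open>All values lie in the bounded set \<open>K\<close>, so the growth exponent \<open>1\<close> suffices.\<close>
  obtain b where b: "b > 0" "\<forall>x\<in>K. norm x \<le> b"
    using compact_imp_bounded[OF K(1)] bounded_pos by blast
  have "X \<in> point_reps \<Omega>"
    unfolding point_reps_def
  proof (intro CollectI conjI ballI)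
    fix \<phi> :: "'a test_fun" assume "\<phi> \<in> mollifiers 0"
    show "X \<phi> \<in> \<Omega>" using X(1) K(2) by blast
    from eventually_compact_admissible[OF \<Omega> K(1,2) \<open>\<phi> \<in> mollifiers 0\<close>]
    show "\<exists>\<epsilon>\<^sub>0>0. \<forall>\<epsilon>. 0 < \<epsilon> \<and> \<epsilon> < \<epsilon>\<^sub>0 \<longrightarrow> (scale_fun \<epsilon> \<phi>, X (scale_fun \<epsilon> \<phi>)) \<in> U_set \<Omega>"
      using X(1) unfolding eventually_at_right_field admissible_points_def by blast
  next
    have "eps_bigo (\<lambda>\<epsilon>. ennreal (norm (X (scale_fun \<epsilon> \<phi>)))) (\<lambda>\<epsilon>. inverse (\<epsilon> ^ 1))" for \<phi>
    proof (subst eps_bigo_iff)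
      have "norm (X (scale_fun \<epsilon> \<phi>)) \<le> b * inverse (\<epsilon> ^ 1)" if "0 < \<epsilon>" "\<epsilon> < 1" for \<epsilon>
      proof -
        have "norm (X (scale_fun \<epsilon> \<phi>)) \<le> b * 1" using b X(1) by simp
        also have "\<dots> \<le> b * inverse (\<epsilon> ^ 1)"
          using that b by (intro mult_left_mono) (auto simp: field_simps)
        finally show ?thesis .
      qed
      then show "\<exists>C>0. \<forall>\<^sub>F \<epsilon> in at_right 0. norm (X (scale_fun \<epsilon> \<phi>)) \<le> C * inverse (\<epsilon> ^ 1)"
        unfolding eventually_at_right_field using b by (meson zero_less_one)
    qed simp
    then show "\<exists>N\<ge>1. \<forall>\<phi>\<in>mollifiers N.
        eps_bigo (\<lambda>\<epsilon>. ennreal (norm (X (scale_fun \<epsilon> \<phi>)))) (\<lambda>\<epsilon>. inverse (\<epsilon> ^ N))"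
      by blast
  qed
  moreover have "compactly_supported_rep \<Omega> X"
    unfolding compactly_supported_rep_def using K X(1) by (meson order_refl zero_less_one)
  ultimately show thesis using that X by blast
qed

lemma uniformly_negligible_if_point_values:
  assumes \<Omega>: "open \<Omega>" and R: "R \<in> basic_space \<Omega>"
    and neg: "\<And>X. X \<in> point_reps \<Omega> \<Longrightarrow> compactly_supported_rep \<Omega> X \<Longrightarrow>
      eval_rep \<Omega> R X \<in> negligible_numbers"
  shows "uniformly_negligible \<Omega> R"
  unfolding uniformly_negligible_def
proof (intro allI impI)
  fix K and m :: nat assume K: "compact K \<and> K \<subseteq> \<Omega>" and m: "1 \<le> m"
  show "\<exists>q\<ge>1. \<forall>\<phi>\<in>mollifiers q. \<exists>C>0. \<forall>\<^sub>F \<epsilon> in at_right 0. \<forall>x\<in>K.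
      cmod (R (scale_fun \<epsilon> \<phi>) x) \<le> C * \<epsilon> ^ m"
  proof (cases "K = {}")
    case True
    then show ?thesis by (auto intro!: exI[of _ 1])
  next
    case False
    then obtain X where X: "X \<in> point_reps \<Omega>" "compactly_supported_rep \<Omega> X"
      "\<And>\<phi>. K \<subseteq> admissible_points \<Omega> \<phi> \<Longrightarrow> X \<phi> \<in> K \<and> (\<forall>x\<in>K. cmod (R \<phi> x) \<le> cmod (R \<phi> (X \<phi>)))"
      using ex_maximizing_point[OF \<Omega> R conjunct1[OF K] conjunct2[OF K]] by metis
    obtain q where q: "1 \<le> q" "\<forall>\<phi>\<in>mollifiers q. \<exists>C>0. \<forall>\<^sub>F \<epsilon> in at_right 0.
        cmod (eval_rep \<Omega> R X (scale_fun \<epsilon> \<phi>)) \<le> C * \<epsilon> ^ m"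
      using neg[OF X(1,2)] m unfolding negligible_numbers_iff by blast
    show ?thesis
    proof (intro exI[of _ q] conjI ballI)
      fix \<phi> :: "'a test_fun" assume \<phi>: "\<phi> \<in> mollifiers q"
      with q obtain C where C: "C > 0" "\<forall>\<^sub>F \<epsilon> in at_right 0.
        cmod (eval_rep \<Omega> R X (scale_fun \<epsilon> \<phi>)) \<le> C * \<epsilon> ^ m" by blast
      have "\<forall>\<^sub>F \<epsilon> in at_right 0. \<forall>x\<in>K. cmod (R (scale_fun \<epsilon> \<phi>) x) \<le> C * \<epsilon> ^ m"
        using C(2) eventually_compact_admissible[OF \<Omega> conjunct1[OF K] conjunct2[OF K] \<phi>]
      proof eventually_elim
        case (elim \<epsilon>)
        let ?\<psi> = "scale_fun \<epsilon> \<phi>"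
        have "eval_rep \<Omega> R X ?\<psi> = R ?\<psi> (X ?\<psi>)"
          using X(3)[OF elim(2)] elim(2) by (auto simp: eval_rep_def admissible_points_def)
        with elim(1) X(3)[OF elim(2)] show ?case by (metis order_trans)
      qed
      with C(1) show "\<exists>C>0. \<forall>\<^sub>F \<epsilon> in at_right 0. \<forall>x\<in>K.
        cmod (R (scale_fun \<epsilon> \<phi>) x) \<le> C * \<epsilon> ^ m" by blast
    qed (use q in auto)
  qed
qed

lemma negligible_funs_iff_point_values:
  assumes "open \<Omega>" "R \<in> moderate \<Omega>"
  shows "R \<in> negligible_funs \<Omega> \<longleftrightarrow> (\<forall>X\<in>point_reps \<Omega>. compactly_supported_rep \<Omega> X \<longrightarrow>
     eval_rep \<Omega> R X \<in> negligible_numbers)"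
  using assms eval_rep_negligible
    negligible_funs_if_order_zero[OF assms uniformly_negligible_if_point_values[OF assms(1)]]
  by (auto simp: moderate_iff)

section \<open>Passage to classes\<close>

lemma negligible_numbers_coset:
  "negligible_numbers +>\<^bsub>moderate_numbers_ring\<^esub> r = {\<lambda>\<phi>. s \<phi> + r \<phi> |s. s \<in> negligible_numbers}"
  by (auto simp: a_r_coset_def' moderate_numbers_ring_def)

lemma coset_self_numbers: "r \<in> negligible_numbers +>\<^bsub>moderate_numbers_ring\<^esub> r"
  unfolding negligible_numbers_coset
  by (intro CollectI exI[of _ "\<lambda>_. 0"]) (simp add: zero_negligible_numbers)

lemma negligible_numbers_coset_eq_iff:
  "negligible_numbers +>\<^bsub>moderate_numbers_ring\<^esub> r = negligible_numbers \<longleftrightarrow> r \<in> negligible_numbers"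
proof
  assume "negligible_numbers +>\<^bsub>moderate_numbers_ring\<^esub> r = negligible_numbers"
  with coset_self_numbers[of r] show "r \<in> negligible_numbers" by argo
next
  assume r: "r \<in> negligible_numbers"
  show "negligible_numbers +>\<^bsub>moderate_numbers_ring\<^esub> r = negligible_numbers"
    unfolding negligible_numbers_coset
  proof safe
    fix s :: "'a test_fun \<Rightarrow> complex" assume s: "s \<in> negligible_numbers"
    show "(\<lambda>\<phi>. s \<phi> + r \<phi>) \<in> negligible_numbers"
      using negligible_numbers_linear[OF s r, of 1] by simp
    show "\<exists>t. s = (\<lambda>\<phi>. t \<phi> + r \<phi>) \<and> t \<in> negligible_numbers"
      using negligible_numbers_linear[OF s r, of "-1"]
      by (intro exI[of _ "\<lambda>\<phi>. s \<phi> + -1 * r \<phi>"]) auto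
  qed
qed

lemma negligible_funs_coset:
  "negligible_funs \<Omega> +>\<^bsub>moderate_ring \<Omega>\<^esub> R = {\<lambda>\<phi> x. S \<phi> x + R \<phi> x |S. S \<in> negligible_funs \<Omega>}"
  by (auto simp: a_r_coset_def' moderate_ring_def)

lemma coset_self_funs: "R \<in> negligible_funs \<Omega> +>\<^bsub>moderate_ring \<Omega>\<^esub> R"
  unfolding negligible_funs_coset
  by (intro CollectI exI[of _ "\<lambda>_ _. 0"]) (simp add: zero_negligible_funs)

lemma negligible_funs_coset_eq_iff:
  assumes \<Omega>: "open \<Omega>"
  shows "negligible_funs \<Omega> +>\<^bsub>moderate_ring \<Omega>\<^esub> R = negligible_funs \<Omega> \<longleftrightarrow> R \<in> negligible_funs \<Omega>"
proof
  assume "negligible_funs \<Omega> +>\<^bsub>moderate_ring \<Omega>\<^esub> R = negligible_funs \<Omega>"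
  with coset_self_funs[of R \<Omega>] show "R \<in> negligible_funs \<Omega>" by argo
next
  assume R: "R \<in> negligible_funs \<Omega>"
  show "negligible_funs \<Omega> +>\<^bsub>moderate_ring \<Omega>\<^esub> R = negligible_funs \<Omega>"
    unfolding negligible_funs_coset
  proof safe
    fix S assume S: "S \<in> negligible_funs \<Omega>"
    show "(\<lambda>\<phi> x. S \<phi> x + R \<phi> x) \<in> negligible_funs \<Omega>"
      using negligible_funs_linear[OF \<Omega> S R, of 1] by simp
    show "\<exists>T. S = (\<lambda>\<phi> x. T \<phi> x + R \<phi> x) \<and> T \<in> negligible_funs \<Omega>"
      using negligible_funs_linear[OF \<Omega> S R, of "-1"]
      by (intro exI[of _ "\<lambda>\<phi> x. S \<phi> x + -1 * R \<phi> x"]) auto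
  qed
qed

lemma point_class_in_gen_points_c:
  assumes "X \<in> point_reps \<Omega>" "compactly_supported_rep \<Omega> X"
  shows "point_rel \<Omega> `` {X} \<in> gen_points_c \<Omega>" "X \<in> point_rel \<Omega> `` {X}"
proof -
  have "eps_bigo (\<lambda>\<epsilon>. ennreal (norm (X (scale_fun \<epsilon> \<phi>) - X (scale_fun \<epsilon> \<phi>)))) (\<lambda>\<epsilon>. \<epsilon> ^ m)" for \<phi> m
    by (subst eps_bigo_iff) (auto simp: eventually_at_right_field intro!: exI[of _ 1])
  then show "X \<in> point_rel \<Omega> `` {X}"
    using assms(1) by (auto simp: point_rel_def)
  then show "point_rel \<Omega> `` {X} \<in> gen_points_c \<Omega>"
    using assms by (auto simp: gen_points_c_def gen_points_def intro: quotientI)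
qed

theorem theorem12:
  fixes \<Omega> :: "(real^'n::finite) set"
    and F :: "('n test_fun \<Rightarrow> real^'n \<Rightarrow> complex) set"
  assumes "open \<Omega>"
    and "F \<in> carrier (gen_functions \<Omega>)"
  shows "F = \<zero>\<^bsub>gen_functions \<Omega>\<^esub> \<longleftrightarrow>
    (\<forall>\<xi>\<in>gen_points_c \<Omega>. point_value \<Omega> F \<xi> = \<zero>\<^bsub>gen_numbers\<^esub>)"
proof -
  have zero: "\<zero>\<^bsub>gen_functions \<Omega>\<^esub> = negligible_funs \<Omega>"
    "\<zero>\<^bsub>gen_numbers\<^esub> = (negligible_numbers :: ('n test_fun \<Rightarrow> complex) set)"
    by (simp_all add: gen_functions_def gen_numbers_def FactRing_def)
  obtain R where R: "R \<in> moderate \<Omega>" "F = negligible_funs \<Omega> +>\<^bsub>moderate_ring \<Omega>\<^esub> R"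
    using assms(2) by (auto simp: gen_functions_def FactRing_def A_RCOSETS_def' moderate_ring_def)
  have "R \<in> F"
    unfolding R(2) by (rule coset_self_funs)
  show ?thesis
    unfolding zero
  proof
    assume F: "F = negligible_funs \<Omega>"
    show "\<forall>\<xi>\<in>gen_points_c \<Omega>. point_value \<Omega> F \<xi> = negligible_numbers"
    proof
      fix \<xi> assume "\<xi> \<in> gen_points_c \<Omega>"
      then obtain X where X: "X \<in> \<xi>" "compactly_supported_rep \<Omega> X"
        by (auto simp: gen_points_c_def)
      have "negligible_numbers +>\<^bsub>moderate_numbers_ring\<^esub> eval_rep \<Omega> S Y = negligible_numbers"
        if "S \<in> F" "compactly_supported_rep \<Omega> Y" for S Y
        using that F by (simp add: negligible_numbers_coset_eq_iff eval_rep_negligible)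
      with X \<open>R \<in> F\<close> show "point_value \<Omega> F \<xi> = negligible_numbers"
        unfolding point_value_def by blast
    qed
  next
    assume van: "\<forall>\<xi>\<in>gen_points_c \<Omega>. point_value \<Omega> F \<xi> = negligible_numbers"
    have "eval_rep \<Omega> R X \<in> negligible_numbers"
      if X: "X \<in> point_reps \<Omega>" "compactly_supported_rep \<Omega> X" for X
    proof -
      have "negligible_numbers +>\<^bsub>moderate_numbers_ring\<^esub> eval_rep \<Omega> R X
          \<subseteq> point_value \<Omega> F (point_rel \<Omega> `` {X})"
        unfolding point_value_def using \<open>R \<in> F\<close> X point_class_in_gen_points_c[OF X] by blast
      then show ?thesis
        using van point_class_in_gen_points_c(1)[OF X] coset_self_numbers by blast
    qed
    then have "R \<in> negligible_funs \<Omega>"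
      using negligible_funs_iff_point_values[OF assms(1) R(1)] by blast
    then show "F = negligible_funs \<Omega>"
      unfolding R(2) using negligible_funs_coset_eq_iff[OF assms(1)] by blast
  qed
qed

end
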